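(* Let $p$ be an odd prime, $q=p^f$, $m\ge 2$, $\omega$ a primitive element of $\mathbb{F}_{q^m}$, and $N\ge 2$ an odd integer with $N\mid\frac{q^m-1}{q-1}$. Assume that $\mathrm{Cay}(\mathbb{F}_{q^m},C_0^{(N,q^m)})$ is strongly regular and that $-2\in\langle p\rangle\le(\mathbb{Z}/N\mathbb{Z})^\ast$. Let $I\subseteq\mathbb{Z}_N$ be the subdifference set defined below, let $2^{-1}I=\{u\in\mathbb{Z}_N: 2u\in I\}$, and let $$X=\{2t \bmod 2N:\ t\in\{0,\dots,N-1\},\ 4t\bmod N\in I\}\subseteq\mathbb{Z}_{2N}.$$ Then for every integer $c$, $$2\,\psi\Big(\omega^c\bigcup_{t\in X}C_t^{(2N,q^m)}\Big)-\psi\Big(\omega^c\bigcup_{t\in 2^{-1}I}C_t^{(N,q^m)}\Big)=\begin{cases}\pm G_{q^m}(\eta),&\text{if } c \bmod N\in 2^{-1}I,\\ 0,&\text{otherwise,}\end{cases}$$ where $\pm G_{q^m}(\eta)$ means the value is either $G_{q^m}(\eta)$ or $-G_{q^m}(\eta)$.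
   Context: For $M\mid q^m-1$ and an integer $i$, $C_i^{(M,q^m)}=\omega^i\langle\omega^M\rangle$. $\mathrm{Cay}(\mathbb{F}_{q^m},D)$ is the graph on $\mathbb{F}_{q^m}$ with $x\sim y$ iff $x-y\in D$; strongly regular means regular, neither complete nor edgeless, with constant numbers of common neighbours for adjacent and for non-adjacent pairs. $\psi$ is the canonical additive character $\psi(x)=e^{2\pi i\,\mathrm{Tr}_{q^m/p}(x)/p}$ of $\mathbb{F}_{q^m}$, $\psi(A)=\sum_{x\in A}\psi(x)$, $\eta$ is the quadratic character of $\mathbb{F}_{q^m}$ and $G_{q^m}(\eta)=\sum_{x\ne0}\eta(x)\psi(x)$. Subdifference set: for $0\le i\le N-1$ let $n_i=|\{x\in C_i^{(N,q^m)}:\mathrm{Tr}_{q^m/q}(x)=0\}|/(q-1)$; under the hypotheses the $n_i$ take exactly two distinct values, so $n_i-n_0\in\{0,\delta\}$ for a fixed nonzero integer $\delta$, and $I=\{i\in\mathbb{Z}_N: n_i-n_0=\delta\}$. *)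

theory Defs
  imports "HOL-Analysis.Analysis"
begin

text \<open>Finite field F_{q^m} is modelled as a finite field type 'a with CARD('a) = q^m,
  q = p^f.  The absolute trace Tr_{q^m/p} and the relative trace Tr_{q^m/q}.\<close>

definition trace_abs :: "nat \<Rightarrow> nat \<Rightarrow> 'a::field \<Rightarrow> 'a" where
  "trace_abs p n x = (\<Sum>i<n. x ^ (p ^ i))"   (* n = f*m, so Tr_{p^n/p} *)

definition trace_rel :: "nat \<Rightarrow> nat \<Rightarrow> 'a::field \<Rightarrow> 'a" where
  "trace_rel q m x = (\<Sum>i<m. x ^ (q ^ i))"

text \<open>Canonical additive character: psi(x) = exp(2 pi i Tr(x)/p), where Tr(x) lies in the
  prime field {of_nat k | k < p}.\<close>
definition add_char :: "nat \<Rightarrow> nat \<Rightarrow> 'a::field \<Rightarrow> complex" where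
  "add_char p n x = (\<Sum>k<p. if of_nat k = trace_abs p n x
                              then cis (2 * pi * real k / real p) else 0)"

definition add_char_set :: "nat \<Rightarrow> nat \<Rightarrow> 'a::field set \<Rightarrow> complex" where
  "add_char_set p n A = (\<Sum>x\<in>A. add_char p n x)"

definition quad_char :: "'a::field \<Rightarrow> complex" where
  "quad_char x = (if x = 0 then 0 else if (\<exists>y. y * y = x) then 1 else -1)"

definition gauss_quad :: "nat \<Rightarrow> nat \<Rightarrow> 'a::{finite,field} itself \<Rightarrow> complex" where
  "gauss_quad p n _ = (\<Sum>x\<in>(UNIV::'a set) - {0}. quad_char x * add_char p n x)"

definition primitive_element :: "'a::{finite,field} \<Rightarrow> bool" where
  "primitive_element w \<longleftrightarrow> w \<noteq> 0 \<and> (\<forall>x. x \<noteq> 0 \<longrightarrow> (\<exists>k::nat. x = w ^ k))"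

definition cyc_class :: "'a::field \<Rightarrow> nat \<Rightarrow> int \<Rightarrow> 'a set" where
  "cyc_class w M i = {w powi (i + int M * j) | j. True}"

definition strongly_regular :: "'v set \<Rightarrow> ('v \<Rightarrow> 'v \<Rightarrow> bool) \<Rightarrow> bool" where
  "strongly_regular V E \<longleftrightarrow>
     finite V \<and> (\<forall>x\<in>V. \<forall>y\<in>V. E x y \<longrightarrow> E y x) \<and> (\<forall>x\<in>V. \<not> E x x) \<and>
     (\<exists>k. \<forall>x\<in>V. card {y\<in>V. E x y} = k) \<and>
     (\<exists>x\<in>V. \<exists>y\<in>V. x \<noteq> y \<and> \<not> E x y) \<and>
     (\<exists>x\<in>V. \<exists>y\<in>V. E x y) \<and>
     (\<exists>lam. \<forall>x\<in>V. \<forall>y\<in>V. x \<noteq> y \<and> E x y \<longrightarrow> card {z\<in>V. E x z \<and> E y z} = lam) \<and>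
     (\<exists>mu. \<forall>x\<in>V. \<forall>y\<in>V. x \<noteq> y \<and> \<not> E x y \<longrightarrow> card {z\<in>V. E x z \<and> E y z} = mu)"

definition cayley_adj :: "'a::ab_group_add set \<Rightarrow> 'a \<Rightarrow> 'a \<Rightarrow> bool" where
  "cayley_adj D x y \<longleftrightarrow> x - y \<in> D"

definition sub_n :: "'a::field \<Rightarrow> nat \<Rightarrow> nat \<Rightarrow> nat \<Rightarrow> int \<Rightarrow> int" where
  "sub_n w q m N i = int (card {x \<in> cyc_class w N i. trace_rel q m x = 0}) div int (q - 1)"

definition sub_delta :: "'a::field \<Rightarrow> nat \<Rightarrow> nat \<Rightarrow> nat \<Rightarrow> int" where
  "sub_delta w q m N = (THE d. d \<noteq> 0 \<and>
      (\<forall>i\<in>{0..<int N}. sub_n w q m N i - sub_n w q m N 0 \<in> {0, d}) \<and>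
      (\<exists>i\<in>{0..<int N}. sub_n w q m N i - sub_n w q m N 0 = d))"

definition subdiff_set :: "'a::field \<Rightarrow> nat \<Rightarrow> nat \<Rightarrow> nat \<Rightarrow> int set" where
  "subdiff_set w q m N =
     {i \<in> {0..<int N}. sub_n w q m N i - sub_n w q m N 0 = sub_delta w q m N}"

end

theory Submission
  imports Defs "HOL-Number_Theory.Residues"
begin

text \<open>
  Let \<open>P(a)\<close> be the sum of \<open>\<psi>\<close> over \<open>C\<^sub>a\<close>. Multiplication by \<open>F\<^sub>q\<^sup>*\<close> shows
  \<open>P(a) = q n\<^sub>a - k\<close>; strong regularity makes all \<open>P(a)\<close> roots of one quadratic equation; and since the
  \<open>N\<close> integers \<open>P(a)\<close> add up to \<open>-1\<close> they are not all equal. Hence \<open>a \<in> I\<close> iff \<open>P(a) \<noteq> P(0)\<close>.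

  No multiplicative characters of order \<open>N\<close> are needed: the Davenport-Hasse product formula for
  the quadratic character is equivalent to the evaluation of the Salie sums
  \<open>\<Sum>\<^sub>y \<eta>(y) \<psi>(y + d/y) = G(\<eta>) \<Sum>\<^bsub>e\<^sup>2=d\<^esub> \<psi>(2e)\<close>. Summing over \<open>d \<in> C\<^sub>c\<close>, and using that \<open>2 \<in> C\<^sub>0\<close> and that
  \<open>P\<close> is invariant under \<open>a \<mapsto> p a\<close>, hence under \<open>a \<mapsto> -2a\<close>, gives
  \<open>\<Sum>\<^sub>y P(c - log y) \<eta>(y) \<psi>(y) = G(\<eta>) P(-c)\<close>. As \<open>P\<close> takes two values, the same identity holds with
  \<open>P\<close> replaced by the indicator function of \<open>I\<close>, and its left-hand side is then the expression in question
  up to the sign \<open>(-1)\<^sup>c\<close>, because a union of classes of order \<open>2N\<close> with even index consists of the squares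
  in a union of classes of order \<open>N\<close>.
\<close>

subsection \<open>The canonical additive character\<close>

locale finite_field_prim =
  fixes p n :: nat and w :: "'a::{finite,field}"
  assumes prime_p: "prime p" and odd_p: "odd p" and n_pos: "n \<ge> 1"
    and card_field: "CARD('a) = p ^ n"
    and prim: "primitive_element w"
begin

definition Q :: nat where "Q = CARD('a) - 1"

lemma Q_eq: "Q = p ^ n - 1"
  by (simp add: Q_def card_field)

lemma p_gt_2: "p > 2"
  using prime_p odd_p prime_ge_2_nat[of p] by (cases "p = 2") auto

lemma card_ge: "p ^ n > 2"
proof -
  have "p ^ 1 \<le> p ^ n" using n_pos p_gt_2 by (intro power_increasing) auto
  then show ?thesis using p_gt_2 by simp
qed

lemma Q_pos: "Q > 0"
  using card_ge by (simp add: Q_eq)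

lemma even_Q: "even Q"
  using odd_p card_ge by (simp add: Q_eq)

section \<open>Characteristic, Frobenius map and the order of the multiplicative group\<close>

lemma char_eq: "CHAR('a) = p"
proof -
  have "CHAR('a) > 0" by (rule finite_imp_CHAR_pos) simp
  then have "prime CHAR('a)" by (rule prime_CHAR_semidom)
  moreover have "CHAR('a) dvd p ^ n" using CHAR_dvd_CARD[where 'a='a] card_field by simp
  ultimately show ?thesis using prime_p
    by (meson prime_dvd_power primes_dvd_imp_eq)
qed

lemma frob_add: "(x + y :: 'a) ^ (p ^ i) = x ^ (p ^ i) + y ^ (p ^ i)"
  using freshmans_dream'[where 'a='a, of "p^i" i x y] prime_p by (simp add: char_eq)

lemma frob_sum: "(sum g A :: 'a) ^ (p ^ i) = (\<Sum>x\<in>A. g x ^ (p ^ i))"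
  using freshmans_dream_sum'[where 'a='a, of "p^i" i g A] prime_p by (simp add: char_eq)

lemma two_nonzero: "(2 :: 'a) \<noteq> 0"
proof
  assume "(2::'a) = 0"
  then have "of_nat 2 = (0::'a)" by simp
  then have "p dvd 2" by (simp only: of_nat_eq_0_iff_char_dvd char_eq)
  then show False using p_gt_2 by (auto dest: dvd_imp_le)
qed

text \<open>Multiplication by \<open>x\<close> permutes the nonzero elements, so their product is
  unchanged although it gains the factor \<open>x ^ Q\<close>.\<close>

lemma power_Q: "x \<noteq> 0 \<Longrightarrow> (x :: 'a) ^ Q = 1"
proof -
  assume x: "x \<noteq> 0"
  let ?S = "UNIV - {0 :: 'a}"
  have "bij_betw (\<lambda>y. x * y) ?S ?S"
    by (rule bij_betwI[where g = "\<lambda>y. y / x"]) (use x in auto)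
  then have "(\<Prod>y\<in>?S. x * y) = (\<Prod>y\<in>?S. y)"
    by (rule prod.reindex_bij_betw)
  moreover have "(\<Prod>y\<in>?S. x * y) = x ^ Q * (\<Prod>y\<in>?S. y)"
    by (simp add: prod.distrib Q_def card_Diff_singleton)
  moreover have "(\<Prod>y\<in>?S. y) \<noteq> 0" by simp
  ultimately show ?thesis by simp
qed

lemma power_card: "(x :: 'a) ^ (p ^ n) = x"
proof (cases "x = 0")
  case True then show ?thesis using card_ge p_gt_2 by (simp add: power_0_left)
next
  case False
  have "p ^ n = Suc Q" using card_ge by (simp add: Q_eq)
  then show ?thesis using power_Q[OF False] by simp
qed

section \<open>Discrete logarithms and cyclotomic classes\<close>

lemma w_nonzero [simp]: "w \<noteq> 0"
  using prim by (simp add: primitive_element_def)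

lemma w_log: assumes "x \<noteq> 0" obtains i :: int where "x = w powi i"
  using prim assms unfolding primitive_element_def by (metis power_int_of_nat)

lemma w_powi_eq_1_iff: "w powi i = 1 \<longleftrightarrow> int Q dvd i"
proof
  assume "int Q dvd i"
  then obtain k where "i = int Q * k" by auto
  then show "w powi i = 1" by (simp add: power_int_mult power_Q)
next
  assume *: "w powi i = 1"
  define k where "k = nat (i mod int Q)"
  have k: "int k = i mod int Q" "k < Q" using Q_pos unfolding k_def by (auto simp: nat_less_iff)
  have "w powi i = w powi (int Q * (i div int Q) + int k)" by (simp add: k)
  also have "\<dots> = w ^ k" by (simp add: power_int_add power_int_mult power_Q)
  finally have wk: "w ^ k = 1" using * by simp
  \<comment> \<open>If \<open>0 < k < Q\<close>, then \<open>w ^ k = 1\<close> leaves at most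
    \<open>k\<close> distinct powers of \<open>w\<close>, too few for the \<open>Q\<close> nonzero
    elements.\<close>
  have "k = 0"
  proof (rule ccontr)
    assume "k \<noteq> 0"
    have "UNIV - {0} \<subseteq> (\<lambda>j. w ^ j) ` {..<k}"
    proof
      fix x :: 'a assume "x \<in> UNIV - {0}"
      then obtain j :: nat where j: "x = w ^ j" using prim by (auto simp: primitive_element_def)
      have "w ^ j = w ^ (k * (j div k) + j mod k)" by simp
      also have "\<dots> = w ^ (j mod k)" unfolding power_add power_mult wk by simp
      finally show "x \<in> (\<lambda>j. w ^ j) ` {..<k}" using j \<open>k \<noteq> 0\<close> by auto
    qed
    then have "card (UNIV - {0::'a}) \<le> k"
      using card_image_le[of "{..<k}" "\<lambda>j. w ^ j"] card_mono[of "(\<lambda>j. w ^ j) ` {..<k}" "UNIV - {0}"] by simp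
    then show False using k by (simp add: Q_def)
  qed
  then show "int Q dvd i" using k by auto
qed

lemma w_powi_eq_iff: "w powi i = w powi j \<longleftrightarrow> int Q dvd (i - j)"
proof -
  have "w powi i = w powi j \<longleftrightarrow> w powi (i - j) = 1" by (simp add: power_int_diff)
  then show ?thesis by (simp add: w_powi_eq_1_iff)
qed

lemma w_powi_in_cyc_class:
  assumes "M dvd Q"
  shows "w powi i \<in> cyc_class w M a \<longleftrightarrow> int M dvd (i - a)"
proof
  assume "w powi i \<in> cyc_class w M a"
  then obtain j where "w powi i = w powi (a + int M * j)" by (auto simp: cyc_class_def)
  then have "int Q dvd i - (a + int M * j)" by (simp add: w_powi_eq_iff)
  then have "int M dvd i - (a + int M * j)" using assms by (meson dvd_trans int_dvd_int_iff)
  then have "int M dvd (i - (a + int M * j)) + int M * j" by (intro dvd_add) auto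
  then show "int M dvd (i - a)" by simp
next
  assume "int M dvd (i - a)"
  then obtain j where "i - a = int M * j" by auto
  then have "i = a + int M * j" by simp
  then show "w powi i \<in> cyc_class w M a" unfolding cyc_class_def by blast
qed

lemma zero_notin_cyc_class [simp]: "0 \<notin> cyc_class w M a"
  by (auto simp: cyc_class_def)

section \<open>The absolute trace and the additive character\<close>

lemma trace_abs_add: "trace_abs p n (x + y :: 'a) = trace_abs p n x + trace_abs p n y"
  by (simp add: trace_abs_def frob_add sum.distrib)

text \<open>Raising to the power \<open>b\<close> moves each summand to the next place, and the last
  one wraps around to \<open>x\<close>. With \<open>b = p\<close> and \<open>b = q\<close> this
  serves both traces.\<close>

lemma sum_frob_shift:
  assumes "(x :: 'a) ^ b ^ k = x" "k > 0"
  shows "(\<Sum>i<k. (x ^ b ^ i) ^ b) = (\<Sum>i<k. x ^ b ^ i)"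
proof -
  have "(\<Sum>i<k. (x ^ b ^ i) ^ b) = (\<Sum>i<k. x ^ b ^ Suc i)" by (simp add: power_mult[symmetric] mult.commute)
  also have "\<dots> + x ^ b ^ 0 = (\<Sum>i<Suc k. x ^ b ^ i)" by (simp only: sum.lessThan_Suc_shift add.commute)
  finally show ?thesis using assms by simp
qed

lemma trace_abs_frob: "trace_abs p n (x :: 'a) ^ p = trace_abs p n x"
proof -
  have "trace_abs p n x ^ p = (\<Sum>i<n. (x ^ p ^ i) ^ p)"
    using frob_sum[of "\<lambda>i. x ^ p ^ i" "{..<n}" 1] by (simp add: trace_abs_def)
  then show ?thesis using sum_frob_shift[OF power_card] n_pos by (simp add: trace_abs_def)
qed

lemma card_roots_le:
  fixes P :: "'a poly"
  assumes "P \<noteq> 0" "\<And>x. x \<in> S \<Longrightarrow> poly P x = 0"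
  shows "card S \<le> degree P"
proof -
  have "card S \<le> card {x. poly P x = 0}" using assms by (intro card_mono) auto
  also have "\<dots> \<le> degree P" using card_poly_roots_bound[OF assms(1)] by simp
  finally show ?thesis .
qed

lemma of_nat_inj: "k < p \<Longrightarrow> l < p \<Longrightarrow> (of_nat k :: 'a) = of_nat l \<longleftrightarrow> k = l"
  by (simp add: of_nat_eq_iff_cong_CHAR char_eq cong_def)

text \<open>The \<open>p\<close> values \<open>of_nat k\<close> are roots of \<open>X^p - X\<close>,
  which has at most \<open>p\<close> roots. Applied to traces, this guarantees a matching summand in
  \<open>add_char\<close>.\<close>

lemma prime_subfield:
  assumes "(x :: 'a) ^ p = x"
  shows "\<exists>k<p. x = of_nat k"
proof -
  let ?A = "(of_nat :: nat \<Rightarrow> 'a) ` {..<p}" and ?B = "{x :: 'a. x ^ p = x}"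
  let ?P = "Polynomial.monom 1 p - Polynomial.monom 1 1 :: 'a poly"
  have cA: "card ?A = p" using of_nat_inj by (subst card_image) (auto simp: inj_on_def)
  have AB: "?A \<subseteq> ?B"
  proof -
    have "(of_nat k :: 'a) ^ p = of_nat k" for k
      by (induction k) (use frob_add[of _ _ 1] p_gt_2 in auto)
    then show ?thesis by auto
  qed
  have cf: "Polynomial.coeff ?P p = 1" using p_gt_2 by simp
  then have "?P \<noteq> 0" by (metis coeff_0 zero_neq_one)
  moreover have "degree ?P \<le> p"
    using p_gt_2 by (intro degree_diff_le) (auto simp: degree_monom_eq)
  ultimately have "card ?B \<le> p" 
    using card_roots_le[of ?P ?B] by (simp add: poly_monom)
  then have "?A = ?B" using AB cA by (intro card_seteq) auto
  then show ?thesis using assms by auto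
qed

text \<open>Dropping the bound \<open>k < p\<close> lets the representatives of two traces be added
  without reduction modulo \<open>p\<close>, as \<open>add_char_add\<close> requires.\<close>

lemma add_char_eq:
  assumes "of_nat k = trace_abs p n (x :: 'a)"
  shows "add_char p n x = cis (2 * pi * real k / real p)"
proof -
  have k: "k mod p < p" using p_gt_2 by simp
  have e: "of_nat (k mod p) = trace_abs p n x"
    using assms by (metis of_nat_eq_iff_cong_CHAR char_eq cong_def mod_mod_trivial)
  have "add_char p n x = (\<Sum>l<p. if l = k mod p then cis (2 * pi * real l / real p) else 0)"
    unfolding add_char_def using of_nat_inj k e by (intro sum.cong refl) (metis lessThan_iff)
  also have "\<dots> = cis (2 * pi * real (k mod p) / real p)" using k by simp
  also have "\<dots> = cis (2 * pi * real k / real p)"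
  proof -
    have "real k = real p * real (k div p) + real (k mod p)"
      by (metis mult_div_mod_eq of_nat_add of_nat_mult)
    then have "2 * pi * real k / real p = 2 * pi * real (k mod p) / real p + 2 * pi * real (k div p)"
      using p_gt_2 by (simp add: field_simps)
    then show ?thesis by (simp add: cis_mult[symmetric] cis_multiple_2pi)
  qed
  finally show ?thesis .
qed

lemma trace_abs_of_nat: obtains k where "k < p" "of_nat k = trace_abs p n (x :: 'a)"
  using prime_subfield[OF trace_abs_frob, of x] by metis

lemma add_char_add: "add_char p n (x + y :: 'a) = add_char p n x * add_char p n y"
proof -
  obtain k l where *: "of_nat k = trace_abs p n x" "of_nat l = trace_abs p n y"
    by (metis trace_abs_of_nat)
  then have "of_nat (k + l) = trace_abs p n (x + y)" by (simp add: trace_abs_add)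
  from add_char_eq[OF this] show ?thesis using add_char_eq[OF *(1)] add_char_eq[OF *(2)]
    by (simp add: cis_mult ring_distribs add_divide_distrib)
qed

lemma add_char_0 [simp]: "add_char p n (0 :: 'a) = 1"
  using add_char_eq[of 0 0] p_gt_2 by (simp add: trace_abs_def power_0_left)

lemma add_char_eq_1_iff: "add_char p n (x :: 'a) = 1 \<longleftrightarrow> trace_abs p n x = 0"
proof
  assume "trace_abs p n x = 0"
  then show "add_char p n x = 1" using add_char_eq[of 0 x] by simp
next
  assume *: "add_char p n x = 1"
  obtain k where k: "k < p" "of_nat k = trace_abs p n x" by (rule trace_abs_of_nat)
  have "cis (2 * pi * real k / real p) = 1" using * add_char_eq[OF k(2)] by simp
  then have "cos (2 * pi * real k / real p) = 1" by (metis cis.sel(1) one_complex.sel(1))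
  then obtain z :: int where "2 * pi * real k / real p = of_int z * 2 * pi"
    using cos_one_2pi_int by blast
  then have "real k = of_int z * real p" using p_gt_2 by (simp add: field_simps)
  then have "int k = z * int p" by (metis of_int_eq_iff of_int_mult of_int_of_nat_eq)
  then have "int p dvd int k" by simp
  then have "p dvd k" by simp
  then have "k = 0" using k(1) by (auto dest: dvd_imp_le)
  then show "trace_abs p n x = 0" using k by simp
qed

text \<open>The polynomial has degree \<open>b ^ (k - 1)\<close>. With \<open>b = p\<close> this
  yields elements of nonzero absolute trace in the whole field and in the subfield.\<close>

lemma card_additive_poly_zeros:
  assumes "k > 0" "b \<ge> 2"
  shows "card {x :: 'a. (\<Sum>i<k. x ^ b ^ i) = 0} \<le> b ^ (k - 1)"
proof -
  let ?P = "(\<Sum>i<k. Polynomial.monom 1 (b ^ i)) :: 'a poly"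
  have "Polynomial.coeff ?P (b ^ (k - 1)) = (\<Sum>i<k. if i = k - 1 then 1 else 0)"
    unfolding coeff_sum Polynomial.coeff_monom using assms by (intro sum.cong) (auto simp: power_inject_exp)
  also have "\<dots> = 1" using assms by simp
  finally have "?P \<noteq> 0" by (metis coeff_0 zero_neq_one)
  moreover have "degree ?P \<le> b ^ (k - 1)"
    using assms by (intro degree_sum_le) (auto simp: degree_monom_eq intro!: power_increasing)
  ultimately show ?thesis
    using card_roots_le[of ?P "{x. (\<Sum>i<k. x ^ b ^ i) = 0}"] by (simp add: poly_sum poly_monom)
qed

text \<open>Translation by \<open>a\<close> permutes \<open>S\<close> and multiplies the sum by a
  value different from 1. A general additive subgroup \<open>S\<close> covers both the whole field
  and lines over the subfield.\<close>

lemma sum_char_zero: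
  fixes S :: "'a set"
  assumes "a \<in> S" "\<And>x y. x \<in> S \<Longrightarrow> y \<in> S \<Longrightarrow> x + y \<in> S" "\<And>x. x \<in> S \<Longrightarrow> - x \<in> S"
    and "add_char p n a \<noteq> 1"
  shows "(\<Sum>x\<in>S. add_char p n x) = 0"
proof -
  have d: "x - a \<in> S" if "x \<in> S" for x
    using assms(2)[OF that assms(3)[OF assms(1)]] by simp
  have "bij_betw (\<lambda>x. x + a) S S"
    by (rule bij_betwI[where g = "\<lambda>x. x - a"]) (use assms(1,2) d in auto)
  then have "(\<Sum>x\<in>S. add_char p n (x + a)) = (\<Sum>x\<in>S. add_char p n x)"
    by (rule sum.reindex_bij_betw)
  then have "(\<Sum>x\<in>S. add_char p n x) * (add_char p n a - 1) = 0"
    unfolding add_char_add sum_distrib_right[symmetric] by (simp add: right_diff_distrib)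
  then show ?thesis using assms(4) by simp
qed

lemma sum_add_char_UNIV: "(\<Sum>x\<in>UNIV. add_char p n (x :: 'a)) = 0"
proof -
  have "card {x :: 'a. trace_abs p n x = 0} \<le> p ^ (n - 1)"
    unfolding trace_abs_def using card_additive_poly_zeros[of n p] n_pos p_gt_2 by simp
  also have "\<dots> < p ^ n" using n_pos p_gt_2 by (intro power_strict_increasing) auto
  finally have "{x :: 'a. trace_abs p n x = 0} \<noteq> UNIV" using card_field by auto
  then obtain a :: 'a where "trace_abs p n a \<noteq> 0" by blast
  then show ?thesis by (intro sum_char_zero[of a]) (auto simp: add_char_eq_1_iff)
qed

lemma sum_add_char_scaled: "a \<noteq> 0 \<Longrightarrow> (\<Sum>x\<in>UNIV. add_char p n (a * x :: 'a)) = 0"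
proof -
  assume a: "a \<noteq> 0"
  have "bij_betw (\<lambda>y. a * y) UNIV UNIV"
    by (rule bij_betwI[where g = "\<lambda>y. y / a"]) (use a in auto)
  from sum.reindex_bij_betw[OF this, of "add_char p n"] show ?thesis by (simp add: sum_add_char_UNIV)
qed

lemma trace_abs_power_p: "trace_abs p n ((x :: 'a) ^ p) = trace_abs p n x"
proof -
  have "trace_abs p n (x ^ p) = (\<Sum>i<n. (x ^ p ^ i) ^ p)"
    by (simp add: trace_abs_def power_mult[symmetric] mult.commute)
  then show ?thesis using sum_frob_shift[OF power_card] n_pos by (simp add: trace_abs_def)
qed

lemma add_char_power_p: "add_char p n ((x :: 'a) ^ p) = add_char p n x"
  by (simp add: add_char_def trace_abs_power_p)

section \<open>The quadratic character\<close>

lemma quad_char_w: "quad_char (w powi i) = (if even i then 1 else - 1)"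
proof -
  have "(\<exists>y. y * y = w powi i) \<longleftrightarrow> even i"
  proof
    assume "\<exists>y. y * y = w powi i"
    then obtain y where y: "y * y = w powi i" by blast
    then have "y \<noteq> 0" by auto
    then obtain j where "y = w powi j" by (rule w_log)
    then have "w powi (j + j) = w powi i" using y \<open>y = _\<close> by (simp only: power_int_add w_nonzero simp_thms)
    \<comment> \<open>Exponents are determined only modulo \<open>Q\<close>; their parity is well
      defined because \<open>Q\<close> is even.\<close>
    then have "int Q dvd j + j - i" by (simp add: w_powi_eq_iff)
    moreover have "2 dvd int Q" using even_Q by simp
    ultimately have "2 dvd j + j - i" by (rule dvd_trans[rotated])
    then show "even i" by presburger
  next
    assume "even i"
    then obtain j where "i = j + j" by (metis evenE mult_2)
    then show "\<exists>y. y * y = w powi i" using power_int_add[of w j j] by (intro exI[of _ "w powi j"]) simp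
  qed
  then show ?thesis by (simp add: quad_char_def)
qed

lemma quad_char_mult: "quad_char (x * y :: 'a) = quad_char x * quad_char y"
proof (cases "x = 0 \<or> y = 0")
  case True then show ?thesis by (auto simp: quad_char_def)
next
  case False
  then obtain i j where "x = w powi i" "y = w powi j" by (metis w_log)
  then have "x * y = w powi (i + j)" by (simp add: power_int_add)
  then show ?thesis using \<open>x = _\<close> \<open>y = _\<close> by (simp add: quad_char_w)
qed

lemma quad_char_square: "x \<noteq> 0 \<Longrightarrow> quad_char (x * x :: 'a) = 1"
  by (auto simp: quad_char_def)

lemma card_square_roots: "of_nat (card {t :: 'a. t * t = D}) = 1 + quad_char D"
proof (cases "\<exists>t. t * t = D")
  case False
  moreover have "D \<noteq> 0" using False by auto
  ultimately show ?thesis by (auto simp: quad_char_def)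
next
  case True
  then obtain t where t: "t * t = D" by blast
  have "{t :: 'a. t * t = D} = {t, - t}" using t by (auto simp: square_eq_iff)
  moreover have "t \<noteq> - t" if "t \<noteq> 0"
  proof
    assume "t = - t"
    then have "2 * t = 0" by (metis mult_2 add.right_inverse)
    then show False using two_nonzero that by simp
  qed
  ultimately show ?thesis using t by (cases "t = 0") (auto simp: quad_char_def)
qed

subsection \<open>Salie sums\<close>


lemma gauss_shift: "(\<Sum>s\<in>UNIV. add_char p n s * quad_char (s + a :: 'a)) = add_char p n (- a) * gauss_quad p n TYPE('a)"
proof -
  have "(\<Sum>s\<in>UNIV. add_char p n s * quad_char (s + a)) = (\<Sum>x\<in>UNIV. add_char p n (x - a) * quad_char x)"
    by (rule sum.reindex_bij_witness[of _ "\<lambda>x. x - a" "\<lambda>s. s + a"]) auto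
  also have "\<dots> = add_char p n (- a) * (\<Sum>x\<in>UNIV. quad_char (x :: 'a) * add_char p n x)"
    unfolding diff_conv_add_uminus add_char_add by (simp add: sum_distrib_left mult_ac)
  also have "(\<Sum>x\<in>UNIV. quad_char (x :: 'a) * add_char p n x) = gauss_quad p n TYPE('a)"
    unfolding gauss_quad_def by (rule sum.mono_neutral_right) (auto simp: quad_char_def)
  finally show ?thesis .
qed

lemma quad_char_sq: "quad_char x * quad_char x = (if x = 0 then 0 else 1)"
  by (simp add: quad_char_def)

text \<open>The fibre is the root set of \<open>y^2 - s y + e^2\<close>, with discriminant
  \<open>(s + 2 e) (s - 2 e)\<close>. On it \<open>(y + e)^2 = y (s + 2 e)\<close>, so all roots
  share the quadratic character of \<open>s + 2 e\<close> unless that element vanishes, and their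
  number is 1 plus the character of the discriminant.\<close>

lemma sum_quad_char_fibre:
  fixes e s :: 'a
  assumes e: "e \<noteq> 0"
  shows "(\<Sum>y | y \<noteq> 0 \<and> y + e * e / y = s. quad_char y) = quad_char (s + 2 * e) + quad_char (s - 2 * e)"
proof -
  let ?S = "{y. y \<noteq> 0 \<and> y + e * e / y = s}"
  have eqn: "y \<noteq> 0 \<and> y + e * e / y = s \<longleftrightarrow> y * y + e * e = s * y" for y
    using e by (cases "y = 0") (auto simp: field_simps)
  \<comment> \<open>In the two degenerate cases there is a double root, one term on the right
    vanishes, and the argument of the other is four times the root.\<close>
  have four: "quad_char (4 * x) = quad_char x" for x :: 'a
    using quad_char_mult[of "2 * 2" x] quad_char_square[OF two_nonzero] by simp
  consider "s = 2 * e" | "s = - (2 * e)" | "s \<noteq> 2 * e" "s \<noteq> - (2 * e)" by blast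
  then show ?thesis
  proof cases
    case 1
    have "y * y + e * e = s * y \<longleftrightarrow> y = e" for y
    proof -
      have "y * y + e * e = s * y \<longleftrightarrow> (y - e) * (y - e) = 0" unfolding 1 by (simp only: algebra_simps) auto
      then show ?thesis by simp
    qed
    then have "?S = {e}" unfolding eqn by auto
    then show ?thesis using 1 four[of e] by (simp add: quad_char_def)
  next
    case 2
    have "y * y + e * e = s * y \<longleftrightarrow> y = - e" for y
    proof -
      have "y * y + e * e = s * y \<longleftrightarrow> (y + e) * (y + e) = 0" unfolding 2 eq_iff_diff_eq_0[of "y * y + e * e"] by (simp add: algebra_simps)
      then show ?thesis by (simp add: eq_neg_iff_add_eq_0)
    qed
    then have "?S = {- e}" unfolding eqn by auto
    then show ?thesis using 2 four[of "- e"] by (simp add: quad_char_def)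
  next
    case 3
    have const: "quad_char y = quad_char (s + 2 * e)" if "y \<in> ?S" for y
    proof -
      have y: "y \<noteq> 0" "y * y + e * e = s * y" using that eqn by auto
      have "y \<noteq> - e"
      proof
        assume "y = - e"
        then have "e * (s + 2 * e) = 0" using y(2) by (simp add: algebra_simps)
        then show False using 3 e by (simp add: eq_neg_iff_add_eq_0)
      qed
      then have "y + e \<noteq> 0" by (simp add: eq_neg_iff_add_eq_0)
      moreover have "(y + e) * (y + e) = y * (s + 2 * e)" using y(2) by (simp add: algebra_simps)
      ultimately have "quad_char y * quad_char (s + 2 * e) = 1"
        by (metis quad_char_square quad_char_mult)
      then show ?thesis by (auto simp: quad_char_def split: if_splits)
    qed
    have half: "2 * (x / 2) = x" for x :: 'a
      using two_nonzero by simp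
    \<comment> \<open>Completing the square matches the roots with the square roots of the
      discriminant.\<close>
    have "bij_betw (\<lambda>y. 2 * y - s) ?S {t. t * t = (s + 2 * e) * (s - 2 * e)}"
    proof (rule bij_betwI[where g = "\<lambda>t. (t + s) / 2"])
      have key: "(2 * y - s) * (2 * y - s) - (s + 2 * e) * (s - 2 * e) = 2 * 2 * (y * y + e * e - s * y)" for y
        by (simp add: algebra_simps)
      show "(\<lambda>y. 2 * y - s) \<in> ?S \<rightarrow> {t. t * t = (s + 2 * e) * (s - 2 * e)}"
      proof
        fix y assume "y \<in> ?S"
        then have "y * y + e * e - s * y = 0" using eqn by simp
        then have "(2 * y - s) * (2 * y - s) - (s + 2 * e) * (s - 2 * e) = 0" unfolding key by simp
        then show "2 * y - s \<in> {t. t * t = (s + 2 * e) * (s - 2 * e)}" by simp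
      qed
      show "(\<lambda>t. (t + s) / 2) \<in> {t. t * t = (s + 2 * e) * (s - 2 * e)} \<rightarrow> ?S"
      proof
        fix t assume t: "t \<in> {t. t * t = (s + 2 * e) * (s - 2 * e)}"
        define y where "y = (t + s) / 2"
        have "2 * y - s = t" unfolding y_def half by simp
        then have "2 * 2 * (y * y + e * e - s * y) = 0" using key[of y] t by simp
        then have "y * y + e * e - s * y = 0" using two_nonzero by (metis mult_eq_0_iff)
        then show "y \<in> ?S" using eqn by auto
      qed
    qed (use two_nonzero in simp, unfold half, simp)
    then have "card ?S = card {t. t * t = (s + 2 * e) * (s - 2 * e)}" by (rule bij_betw_same_card)
    then have "of_nat (card ?S) = 1 + quad_char (s + 2 * e) * quad_char (s - 2 * e)"
      by (simp only: card_square_roots quad_char_mult)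
    moreover have "s + 2 * e \<noteq> 0" using 3 by (simp add: eq_neg_iff_add_eq_0)
    moreover have "(\<Sum>y\<in>?S. quad_char y) = of_nat (card ?S) * quad_char (s + 2 * e)"
      using const by simp
    ultimately show ?thesis using quad_char_sq[of "s + 2 * e"] by (simp add: algebra_simps)
  qed
qed

text \<open>For a non-square \<open>d\<close>, the elements \<open>y\<close> and
  \<open>d / y\<close> have opposite characters and the sum cancels. For \<open>d = e^2\<close>,
  sorting the terms by \<open>s = y + d / y\<close> leaves two shifted Gauss sums, one for each
  square root of \<open>d\<close>.\<close>

lemma salie_sum:
  fixes d :: 'a
  assumes d: "d \<noteq> 0"
  shows "(\<Sum>y\<in>-{0}. quad_char y * add_char p n (y + d / y)) = gauss_quad p n TYPE('a) * (\<Sum>e | e * e = d. add_char p n (2 * e))"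
proof (cases "\<exists>e. e * e = d")
  case False
  let ?S = "\<Sum>y\<in>-{0}. quad_char y * add_char p n (y + d / y)"
  have inv: "quad_char (d / y) = - quad_char y" if "y \<noteq> 0" for y
  proof -
    have "quad_char (d / y) * quad_char y = - 1"
      using quad_char_mult[of "d / y" y] that d False by (simp add: quad_char_def)
    then show ?thesis by (auto simp: quad_char_def split: if_splits)
  qed
  have "?S = (\<Sum>y\<in>-{0}. quad_char (d / y) * add_char p n (d / y + y))"
    by (rule sum.reindex_bij_witness[of _ "\<lambda>y. d / y" "\<lambda>y. d / y"]) (use d in auto)
  also have "\<dots> = (\<Sum>y\<in>-{0}. - (quad_char y * add_char p n (y + d / y)))"
    by (rule sum.cong) (auto simp: inv add.commute)
  also have "\<dots> = - ?S" by (rule sum_negf)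
  finally have "?S = 0" by simp
  moreover have "{e. e * e = d} = {}" using False by auto
  ultimately show ?thesis by simp
next
  case True
  then obtain e where e: "e * e = d" by blast
  then have e0: "e \<noteq> 0" using d by auto
  have "(\<Sum>y\<in>-{0}. quad_char y * add_char p n (y + d / y)) =
        (\<Sum>s\<in>UNIV. \<Sum>y | y \<in> -{0} \<and> y + d / y = s. quad_char y * add_char p n (y + d / y))"
    by (rule sum.group[symmetric]) auto
  also have "\<dots> = (\<Sum>s\<in>UNIV. add_char p n s * (\<Sum>y | y \<noteq> 0 \<and> y + e * e / y = s. quad_char y))"
    unfolding sum_distrib_left using e by (intro sum.cong) auto
  also have "\<dots> = (\<Sum>s\<in>UNIV. add_char p n s * quad_char (s + 2 * e) + add_char p n s * quad_char (s + - (2 * e)))"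
    unfolding sum_quad_char_fibre[OF e0] by (simp add: ring_distribs)
  also have "\<dots> = gauss_quad p n TYPE('a) * (add_char p n (2 * e) + add_char p n (- (2 * e)))"
    unfolding sum.distrib gauss_shift by (simp add: algebra_simps)
  also have "add_char p n (2 * e) + add_char p n (- (2 * e)) = (\<Sum>e\<in>{e, - e}. add_char p n (2 * e))"
  proof -
    have "e \<noteq> - e"
    proof
      assume "e = - e"
      then have "2 * e = 0" by (metis mult_2 add.right_inverse)
      then show False using two_nonzero e0 by simp
    qed
    then show ?thesis by simp
  qed
  also have "{e, - e} = {e. e * e = d}" using e by (auto simp: square_eq_iff)
  finally show ?thesis .
qed

subsection \<open>Gauss periods\<close>

lemma cyc_class_cong:
  assumes "int M dvd a - b"
  shows "cyc_class w M a = cyc_class w M b"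
proof -
  have "cyc_class w M a \<subseteq> cyc_class w M b" if ab: "int M dvd a - b" for a b
  proof
    fix x assume "x \<in> cyc_class w M a"
    moreover obtain k where "a - b = int M * k" using ab by auto
    ultimately obtain j where "x = w powi (b + int M * (k + j))" 
      by (auto simp: cyc_class_def algebra_simps)
    then show "x \<in> cyc_class w M b" by (auto simp: cyc_class_def)
  qed
  from this[of a b] this[of b a] assms show ?thesis by (metis dvd_diff_commute subset_antisym)
qed

text \<open>The choice is unique only modulo \<open>Q\<close>, which suffices because the value is
  read only modulo divisors of \<open>Q\<close> or as an exponent of \<open>w\<close>. At 0 it is
  unspecified.\<close>

definition dlog :: "'a \<Rightarrow> int" where "dlog x = (SOME i. x = w powi i)"

lemma powi_dlog: "x \<noteq> 0 \<Longrightarrow> w powi dlog x = x"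
  unfolding dlog_def by (metis (mono_tags, lifting) someI_ex w_log)

lemma in_cyc_class_iff: "M dvd Q \<Longrightarrow> x \<in> cyc_class w M a \<longleftrightarrow> x \<noteq> 0 \<and> int M dvd dlog x - a"
  using w_powi_in_cyc_class[of M "dlog x" a] powi_dlog[of x] by (cases "x = 0") auto

lemma cyc_class_mult_iff:
  assumes "M dvd Q"
  shows "w powi i * x \<in> cyc_class w M a \<longleftrightarrow> x \<in> cyc_class w M (a - i)"
proof (cases "x = 0")
  case False
  then obtain j where x: "x = w powi j" by (rule w_log)
  have "w powi i * x = w powi (i + j)" by (simp add: x power_int_add)
  then show ?thesis unfolding x using w_powi_in_cyc_class[OF assms] by (simp add: algebra_simps)
qed simp

lemma bij_mult_cyc_class:
  assumes "M dvd Q"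
  shows "bij_betw (\<lambda>x. w powi i * x) (cyc_class w M a) (cyc_class w M (a + i))"
proof (rule bij_betwI[where g = "\<lambda>x. w powi (- i) * x"])
  show "(\<lambda>x. w powi (- i) * x) \<in> cyc_class w M (a + i) \<rightarrow> cyc_class w M a"
    unfolding Pi_iff cyc_class_mult_iff[OF assms] by simp
qed (auto simp: cyc_class_mult_iff[OF assms] mult.assoc[symmetric] power_int_minus)

definition period :: "nat \<Rightarrow> int \<Rightarrow> complex" where
  "period M a = (\<Sum>x\<in>cyc_class w M a. add_char p n x)"

lemma period_cong: "int M dvd a - b \<Longrightarrow> period M a = period M b"
  by (simp add: period_def cyc_class_cong)

text \<open>The Frobenius map sends the class of \<open>a\<close> onto the class of
  \<open>p a\<close> and preserves \<open>add_char\<close>. Its inverse is the power map with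
  exponent \<open>p ^ (n - 1)\<close>, because \<open>x ^ p ^ n = x\<close>.\<close>

lemma period_mult_char: "period M (int p * a) = period M a" if M: "M dvd Q"
proof -
  have pinv: "(x ^ p) ^ p ^ (n - 1) = x" "(x ^ p ^ (n - 1)) ^ p = x" for x :: 'a
      using power_card[of x] n_pos unfolding power_mult[symmetric]
      by (metis One_nat_def Suc_pred' mult.commute power_Suc power_card less_eq_Suc_le)+
  have "bij_betw (\<lambda>x. x ^ p) (cyc_class w M a) (cyc_class w M (int p * a))"
  proof (rule bij_betwI[where g = "\<lambda>x. x ^ p ^ (n - 1)"])
    have pow: "x ^ k \<in> cyc_class w M (int k * a)" if "x \<in> cyc_class w M a" for x k a
    proof -
      have "x ^ k = w powi (int k * dlog x)"
        using that powi_dlog[of x] by (metis mult.commute power_int_power' zero_notin_cyc_class)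
      moreover have "int M dvd int k * dlog x - int k * a"
        using that in_cyc_class_iff[OF M] by (metis dvd_mult right_diff_distrib')
      ultimately show ?thesis using w_powi_in_cyc_class[OF M] by simp
    qed
    show "(\<lambda>x. x ^ p) \<in> cyc_class w M a \<rightarrow> cyc_class w M (int p * a)" using pow by auto
    have "int M dvd int (p ^ (n - 1)) * (int p * a) - a"
    proof -
      have "int (p ^ (n - 1)) * (int p * a) - a = int Q * a"
      proof -
        have "int (p ^ (n - 1)) * int p = int (p ^ n)" using n_pos
          by (metis One_nat_def Suc_pred' less_eq_Suc_le of_nat_mult power_Suc2)
        moreover have "int (p ^ n) = int Q + 1" using card_ge by (simp add: Q_eq of_nat_diff)
        ultimately show ?thesis by (metis add_diff_cancel_right' distrib_right mult.assoc mult_1)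
      qed
      then show ?thesis using M by simp
    qed
    then have "cyc_class w M (int (p ^ (n - 1)) * (int p * a)) = cyc_class w M a" by (rule cyc_class_cong)
    then show "(\<lambda>x. x ^ p ^ (n - 1)) \<in> cyc_class w M (int p * a) \<rightarrow> cyc_class w M a"
      using pow by blast
  qed (simp_all only: pinv)
  then show ?thesis unfolding period_def
    using sum.reindex_bij_betw[of "\<lambda>x :: 'a. x ^ p" _ _ "add_char p n"] by (simp add: add_char_power_p)
qed

lemma period_mult_char_power: "M dvd Q \<Longrightarrow> period M (int p ^ k * a) = period M a"
  by (induction k) (simp_all add: period_mult_char mult.assoc)

text \<open>The Salie evaluation, summed over the products \<open>d = x y\<close> lying in one cyclotomic class.\<close>

lemma period_convolution:
  assumes M: "M dvd Q" "odd M" and two: "2 \<in> cyc_class w M 0" and s: "int M dvd 2 * s - c"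
  shows "(\<Sum>y\<in>-{0}. period M (c - dlog y) * (quad_char y * add_char p n y)) = gauss_quad p n TYPE('a) * period M s"
proof -
  \<comment> \<open>As \<open>d\<close> runs through the class of \<open>c\<close>, the quotient
    \<open>d / y\<close> runs through the class of \<open>c - dlog y\<close>.\<close>
  have per: "period M (c - dlog y) = (\<Sum>d\<in>cyc_class w M c. add_char p n (d / y))" if "y \<noteq> 0" for y
  proof -
    have "(\<Sum>d\<in>cyc_class w M c. add_char p n (w powi (- dlog y) * d)) = period M (c + - dlog y)"
      unfolding period_def by (rule sum.reindex_bij_betw[OF bij_mult_cyc_class[OF M(1)]])
    moreover have "w powi (- dlog y) * d = d / y" for d
      using powi_dlog[OF that] by (simp add: power_int_minus divide_inverse)
    ultimately show ?thesis by simp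
  qed
  \<comment> \<open>Halving modulo the odd number \<open>M\<close> is unique, so all square roots of
    elements of the class of \<open>c\<close> lie in the single class of \<open>s\<close>.\<close>
  have dvd_iff: "int M dvd 2 * i - c \<longleftrightarrow> int M dvd i - s" for i
  proof -
    have "int M dvd 2 * i - c \<longleftrightarrow> int M dvd (2 * i - c) - (2 * s - c)"
      using s by (metis dvd_diff dvd_diff_commute diff_diff_eq2 add_diff_cancel_left' dvd_add_left_iff add.commute diff_add_cancel)
    also have "(2 * i - c) - (2 * s - c) = 2 * (i - s)" by simp
    also have "int M dvd 2 * (i - s) \<longleftrightarrow> int M dvd i - s"
      using M(2) by (intro coprime_dvd_mult_right_iff) simp
    finally show ?thesis .
  qed
  have "(\<Sum>y\<in>-{0}. period M (c - dlog y) * (quad_char y * add_char p n y)) =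
        (\<Sum>y\<in>-{0}. \<Sum>d\<in>cyc_class w M c. quad_char y * add_char p n (y + d / y))"
    by (intro sum.cong refl) (simp add: per sum_distrib_left sum_distrib_right add_char_add mult_ac)
  also have "\<dots> = (\<Sum>d\<in>cyc_class w M c. \<Sum>y\<in>-{0}. quad_char y * add_char p n (y + d / y))"
    by (rule sum.swap)
  also have "\<dots> = (\<Sum>d\<in>cyc_class w M c. gauss_quad p n TYPE('a) * (\<Sum>e | e * e = d. add_char p n (2 * e)))"
    by (intro sum.cong refl salie_sum) auto
  also have "\<dots> = gauss_quad p n TYPE('a) * (\<Sum>d\<in>cyc_class w M c. \<Sum>e | e * e = d. add_char p n (2 * e))"
    by (simp add: sum_distrib_left)
  also have "(\<Sum>d\<in>cyc_class w M c. \<Sum>e | e * e = d. add_char p n (2 * e)) =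
             (\<Sum>d\<in>cyc_class w M c. \<Sum>e | e \<in> cyc_class w M s \<and> e * e = d. add_char p n (2 * e))"
  proof (intro sum.cong refl)
    fix d assume d: "d \<in> cyc_class w M c"
    show "{e. e * e = d} = {e. e \<in> cyc_class w M s \<and> e * e = d}"
    proof (intro Collect_cong iffI conjI)
      fix e assume e: "e * e = d"
      then have e0: "e \<noteq> 0" using d by auto
      have "d = w powi (2 * dlog e)" using e powi_dlog[OF e0] power_int_add[of w "dlog e" "dlog e"] by simp
      then show "e \<in> cyc_class w M s"
        using d dvd_iff e0 by (simp add: w_powi_in_cyc_class[OF M(1)] in_cyc_class_iff[OF M(1), of e])
    qed auto
  qed
  also have "\<dots> = (\<Sum>e\<in>cyc_class w M s. add_char p n (2 * e))"
  proof (rule sum.group)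
    show "(\<lambda>e. e * e) ` cyc_class w M s \<subseteq> cyc_class w M c"
    proof
      fix d assume "d \<in> (\<lambda>e. e * e) ` cyc_class w M s"
      then obtain e where e: "e \<in> cyc_class w M s" "d = e * e" by auto
      then have e0: "e \<noteq> 0" "int M dvd dlog e - s" using in_cyc_class_iff[OF M(1)] by auto
      have "d = w powi (2 * dlog e)" using e powi_dlog[OF e0(1)] power_int_add[of w "dlog e" "dlog e"] by simp
      then show "d \<in> cyc_class w M c" using e0 dvd_iff by (simp add: w_powi_in_cyc_class[OF M(1)])
    qed
  qed auto
  \<comment> \<open>Multiplication by 2 fixes the class of \<open>s\<close>, because 2 lies in the
    class of 0.\<close>
  also have "\<dots> = period M s"
  proof -
    have "(\<Sum>e\<in>cyc_class w M s. add_char p n (w powi (dlog 2) * e)) = period M (s + dlog 2)"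
      unfolding period_def by (rule sum.reindex_bij_betw[OF bij_mult_cyc_class[OF M(1)]])
    also have "\<dots> = period M s" using two in_cyc_class_iff[OF M(1)] by (intro period_cong) auto
    finally show ?thesis using powi_dlog[OF two_nonzero] by simp
  qed
  finally show ?thesis .
qed

section \<open>Partition of the nonzero elements into classes\<close>

lemma cyc_classes_disjoint:
  assumes "M dvd Q" "i \<in> {0..<int M}" "j \<in> {0..<int M}" "i \<noteq> j"
  shows "cyc_class w M i \<inter> cyc_class w M j = {}"
proof (rule ccontr)
  assume "\<not> ?thesis"
  then obtain x where "int M dvd dlog x - i" "int M dvd dlog x - j"
    using in_cyc_class_iff[OF assms(1)] by auto
  then have "i mod int M = j mod int M" by (metis mod_eq_dvd_iff)
  then show False using assms by simp
qed

lemma cyc_classes_cover: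
  assumes "M dvd Q"
  shows "(\<Union>i\<in>{0..<int M}. cyc_class w M i) = - {0}"
proof -
  have M: "M > 0" using assms Q_pos by (cases M) auto
  have "x \<in> cyc_class w M (dlog x mod int M)" if "x \<noteq> 0" for x
    using that in_cyc_class_iff[OF assms] by simp
  then have "\<exists>i\<in>{0..<int M}. x \<in> cyc_class w M i" if "x \<noteq> 0" for x
    using that M by (intro bexI[of _ "dlog x mod int M"]) auto
  then show ?thesis by auto
qed

lemma card_cyc_class:
  assumes "M dvd Q"
  shows "M * card (cyc_class w M a) = Q"
proof -
  have eq: "card (cyc_class w M i) = card (cyc_class w M a)" for i
    using bij_betw_same_card[OF bij_mult_cyc_class[OF assms, of "a - i" i]] by simp
  have "Q = card (- {0::'a})" by (simp add: Q_def Compl_eq_Diff_UNIV)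
  also have "\<dots> = (\<Sum>i\<in>{0..<int M}. card (cyc_class w M i))"
    using cyc_classes_disjoint[OF assms]
    by (subst cyc_classes_cover[OF assms, symmetric], intro card_UN_disjoint) auto
  also have "\<dots> = M * card (cyc_class w M a)" by (subst eq) simp
  finally show ?thesis by simp
qed

lemma sum_period:
  assumes "M dvd Q"
  shows "(\<Sum>i\<in>{0..<int M}. period M i) = - 1"
proof -
  have "(\<Sum>i\<in>{0..<int M}. period M i) = (\<Sum>x\<in>-{0}. add_char p n (x :: 'a))"
    unfolding period_def using cyc_classes_disjoint[OF assms]
    by (subst cyc_classes_cover[OF assms, symmetric], intro sum.UNION_disjoint[symmetric]) auto
  also have "\<dots> = - 1"
    using sum_add_char_UNIV sum.remove[of UNIV "0::'a" "add_char p n"]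
    by (simp add: Compl_eq_Diff_UNIV eq_neg_iff_add_eq_0 add.commute)
  finally show ?thesis .
qed


text \<open>The periods are eigenvalues of the Cayley graph. The square of a period is a character
  sum over differences of two elements of the connection set, and a difference occurs with
  multiplicity the valency at 0, \<open>lam\<close> on the set and \<open>mu\<close> elsewhere.
  Hence \<open>A\<close> is the valency minus \<open>mu\<close>, and
  \<open>B = lam - mu\<close>.\<close>

lemma srg_period_quadratic:
  assumes M: "M dvd Q" and srg: "strongly_regular (UNIV :: 'a set) (cayley_adj (cyc_class w M 0))"
  obtains A B where "\<And>i. period M i * period M i = A + B * period M i"
proof -
  define D where "D = cyc_class w M 0"
  obtain lam mu :: nat where
    sym: "\<And>x y. x - y \<in> D \<Longrightarrow> y - x \<in> D"
    and lam: "\<And>x y. x \<noteq> y \<Longrightarrow> x - y \<in> D \<Longrightarrow> card {z. x - z \<in> D \<and> y - z \<in> D} = lam"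
    and mu: "\<And>x y. x \<noteq> y \<Longrightarrow> x - y \<notin> D \<Longrightarrow> card {z. x - z \<in> D \<and> y - z \<in> D} = mu"
  proof -
    have E: "cayley_adj D x y \<longleftrightarrow> x - y \<in> D" for x y by (simp add: cayley_adj_def)
    from srg show thesis
      unfolding strongly_regular_def D_def[symmetric] E
      by (elim conjE exE) (rule that; simp)
  qed
  have minus_D: "- x \<in> D" if "x \<in> D" for x using sym[of x 0] that by simp
  let ?r = "\<lambda>x. card {z. x - z \<in> D \<and> - z \<in> D}"
  have "period M i * period M i = (of_nat (?r 0) - of_nat mu) + (of_nat lam - of_nat mu) * period M i" for i
  proof -
    let ?b = "w powi i"
    have per: "period M i = (\<Sum>d\<in>D. add_char p n (?b * d))"
      using sum.reindex_bij_betw[OF bij_mult_cyc_class[OF M, of i 0], of "add_char p n"]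
      by (simp add: period_def D_def)
    \<comment> \<open>Adjacency is symmetric, so \<open>D\<close> is closed under negation; one
      factor of the square is taken at \<open>- d\<close> in order to obtain differences.\<close>
    have per': "period M i = (\<Sum>d\<in>D. add_char p n (?b * (- d)))"
      unfolding per by (rule sum.reindex_bij_witness[of _ uminus uminus]) (use minus_D in auto)
    have "period M i * period M i = (\<Sum>(d, d')\<in>D \<times> D. add_char p n (?b * (d - d')))"
    proof -
      have "period M i * period M i = (\<Sum>d\<in>D. \<Sum>d'\<in>D. add_char p n (?b * d) * add_char p n (?b * (- d')))"
        by (subst (1) per, subst per') (simp only: sum_product)
      then show ?thesis
        by (simp add: sum.cartesian_product add_char_add[symmetric] right_diff_distrib)
    qed
    also have "\<dots> = (\<Sum>x\<in>UNIV. \<Sum>dd | dd \<in> D \<times> D \<and> fst dd - snd dd = x. add_char p n (?b * (fst dd - snd dd)))"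
      by (subst sum.group) (auto simp: case_prod_beta)
    also have "\<dots> = (\<Sum>x\<in>UNIV. of_nat (?r x) * add_char p n (?b * x))"
    proof (rule sum.cong[OF refl])
      fix x
      have "card {dd. dd \<in> D \<times> D \<and> fst dd - snd dd = x} = ?r x"
        by (rule bij_betw_same_card[of "\<lambda>dd. - snd dd"],
            rule bij_betwI[where g = "\<lambda>z. (x - z, - z)"]) auto
      moreover have "(\<Sum>dd | dd \<in> D \<times> D \<and> fst dd - snd dd = x. add_char p n (?b * (fst dd - snd dd))) =
           (\<Sum>dd | dd \<in> D \<times> D \<and> fst dd - snd dd = x. add_char p n (?b * x))"
        by (intro sum.cong) auto
      ultimately show "(\<Sum>dd | dd \<in> D \<times> D \<and> fst dd - snd dd = x. add_char p n (?b * (fst dd - snd dd))) =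
           of_nat (?r x) * add_char p n (?b * x)"
        by simp
    qed
    \<comment> \<open>The multiplicity is \<open>mu\<close> everywhere plus corrections on
      \<open>D\<close> and at 0; the constant part then vanishes by orthogonality.\<close>
    also have "\<dots> = (\<Sum>x\<in>UNIV. of_nat mu * add_char p n (?b * x)
        + (if x \<in> D then (of_nat lam - of_nat mu) * add_char p n (?b * x) else 0)
        + (if x = 0 then of_nat (?r 0) - of_nat mu else 0))"
    proof (rule sum.cong[OF refl])
      fix x
      have "0 \<notin> D" by (simp add: D_def)
      then show "of_nat (?r x) * add_char p n (?b * x) = of_nat mu * add_char p n (?b * x)
        + (if x \<in> D then (of_nat lam - of_nat mu) * add_char p n (?b * x) else 0)
        + (if x = 0 then of_nat (?r 0) - of_nat mu else 0)"
        using lam[of x 0] mu[of x 0] by (cases "x = 0"; cases "x \<in> D") (auto simp: algebra_simps)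
    qed
    also have "\<dots> = of_nat mu * (\<Sum>x\<in>UNIV. add_char p n (?b * x))
        + (of_nat lam - of_nat mu) * period M i + (of_nat (?r 0) - of_nat mu)"
      unfolding per by (simp add: sum.distrib sum_distrib_left sum.If_cases)
    also have "(\<Sum>x\<in>UNIV. add_char p n (?b * x)) = 0"
      by (rule sum_add_char_scaled) simp
    finally show ?thesis by simp
  qed
  then show thesis by (rule that)
qed

end

subsection \<open>The subfield and the subdifference set\<close>

locale finite_field_tower = finite_field_prim p "f * m" w
  for p f m :: nat and w :: "'a::{finite,field}"
begin

section \<open>The subfield of order \<open>q\<close>\<close>

definition q :: nat where "q = p ^ f"

text \<open>The index of the multiplicative group of the subfield, whose cosets are therefore the
  classes of order \<open>M\<close>.\<close>

definition M :: nat where "M = (q ^ m - 1) div (q - 1)"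

lemma fm_pos: "f > 0" "m > 0"
  using n_pos by auto

lemma q_pow: "q ^ m = p ^ (f * m)"
  by (simp add: q_def power_mult)

lemma q_gt_2: "q > 2"
proof -
  have "p ^ 1 \<le> p ^ f" using fm_pos p_gt_2 by (intro power_increasing) auto
  then show ?thesis using p_gt_2 by (simp add: q_def)
qed

lemma M_mult: "M * (q - 1) = Q"
proof -
  have "int q - 1 dvd int q ^ m - 1"
    using power_diff_1_eq[of "int q" m] by simp
  then have "int (q - 1) dvd int (q ^ m - 1)" using q_gt_2 by (simp add: of_nat_diff)
  then have "q - 1 dvd q ^ m - 1" by (simp only: int_dvd_int_iff)
  then show ?thesis by (simp add: M_def Q_eq q_pow)
qed

lemma M_dvd: "M dvd Q"
  using M_mult by (metis dvd_triv_left)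

text \<open>The multiplicative group of the subfield, encoded as a cyclotomic class so that the
  results on classes apply to it.\<close>

definition U :: "'a set" where "U = cyc_class w M 0"

lemma zero_notin_U [simp]: "0 \<notin> U"
  by (simp add: U_def)

lemma U_iff: "x \<in> U \<longleftrightarrow> x \<noteq> 0 \<and> x ^ q = x"
proof (cases "x = 0")
  case False
  then obtain i where x: "x = w powi i" by (rule w_log)
  have q: "q = Suc (q - 1)" using q_gt_2 by simp
  have "x ^ q = x \<longleftrightarrow> x ^ (q - 1) = 1" using False by (subst q) simp
  also have "\<dots> \<longleftrightarrow> w powi (i * int (q - 1)) = 1" unfolding x by (simp only: power_int_power')
  also have "\<dots> \<longleftrightarrow> int M * int (q - 1) dvd i * int (q - 1)"
    by (simp only: w_powi_eq_1_iff M_mult[symmetric] of_nat_mult)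
  also have "\<dots> \<longleftrightarrow> x \<in> U"
    using q_gt_2 w_powi_in_cyc_class[OF M_dvd, of i 0] by (simp add: x U_def)
  finally show ?thesis using False by simp
qed simp

lemma insert_0_U: "insert 0 U = {x. x ^ q = x}"
proof -
  have "0 ^ q = (0 :: 'a)" using q_gt_2 by (simp add: power_0_left)
  then show ?thesis using U_iff by blast
qed

lemma card_U: "card U = q - 1"
proof -
  have "M * card U = M * (q - 1)" using card_cyc_class[OF M_dvd, of 0] M_mult by (simp add: U_def)
  moreover have "M > 0" using M_mult Q_pos by (cases M) auto
  ultimately show ?thesis by simp
qed

lemma card_subfield: "card (insert 0 U) = q"
  using q_gt_2 by (simp add: card_U)

lemma power_q_add: "(x + y :: 'a) ^ q = x ^ q + y ^ q"
  unfolding q_def by (rule frob_add)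

lemma power_q_pow: "(x :: 'a) ^ q = x \<Longrightarrow> x ^ q ^ i = x"
proof (induction i)
  case (Suc i)
  have "x ^ q ^ Suc i = (x ^ q) ^ q ^ i" by (simp only: power_Suc power_mult)
  then show ?case using Suc by simp
qed simp

section \<open>The relative trace and character sums over lines\<close>

lemma trace_rel_in_subfield: "trace_rel q m (x :: 'a) ^ q = trace_rel q m x"
proof -
  have "trace_rel q m x ^ q = (\<Sum>i<m. (x ^ q ^ i) ^ q)"
    unfolding trace_rel_def q_def by (rule frob_sum)
  also have "\<dots> = trace_rel q m x"
    unfolding trace_rel_def using fm_pos by (intro sum_frob_shift) (simp_all only: q_pow power_card)
  finally show ?thesis .
qed

lemma trace_rel_scale: "(c :: 'a) ^ q = c \<Longrightarrow> trace_rel q m (c * x) = c * trace_rel q m x"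
  by (simp add: trace_rel_def power_mult_distrib power_q_pow sum_distrib_left)

text \<open>Each index below \<open>f * m\<close> is uniquely \<open>j * f + i\<close> with
  \<open>i < f\<close> and \<open>j < m\<close>.\<close>

lemma trace_tower: "trace_abs p (f * m) (x :: 'a) = (\<Sum>i<f. trace_rel q m x ^ p ^ i)"
proof -
  have "(\<Sum>i<f. trace_rel q m x ^ p ^ i) = (\<Sum>i<f. \<Sum>j<m. (x ^ q ^ j) ^ p ^ i)"
    unfolding trace_rel_def by (simp add: frob_sum)
  also have "\<dots> = (\<Sum>j<m. \<Sum>i<f. x ^ p ^ (j * f + i))"
    unfolding q_def by (subst sum.swap) (simp add: power_mult[symmetric] power_add mult.commute)
  also have "\<dots> = (\<Sum>j<m. \<Sum>i\<in>{j * f..<j * f + f}. x ^ p ^ i)"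
  proof (rule sum.cong[OF refl])
    fix j
    show "(\<Sum>i<f. x ^ p ^ (j * f + i)) = (\<Sum>i\<in>{j * f..<j * f + f}. x ^ p ^ i)"
      by (rule sum.reindex_bij_witness[of _ "\<lambda>i. i - j * f" "\<lambda>i. j * f + i"]) auto
  qed
  also have "\<dots> = (\<Sum>i<f * m. x ^ p ^ i)" 
    by (subst sum.nat_group) (simp add: mult.commute)
  finally show ?thesis by (simp add: trace_abs_def)
qed

text \<open>This is orthogonality on the line spanned by \<open>x\<close> over the subfield: the
  character is trivial there exactly when the relative trace of \<open>x\<close> vanishes. The term
  \<open>- 1\<close> removes the multiple by 0.\<close>

lemma sum_add_char_line:
  assumes x: "x \<noteq> 0"
  shows "(\<Sum>c\<in>U. add_char p (f * m) (c * x)) = (if trace_rel q m x = 0 then of_nat q else 0) - 1"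
proof -
  let ?F = "insert 0 U"
  have mem: "c \<in> ?F \<longleftrightarrow> c ^ q = c" for c using insert_0_U by auto
  have "(\<Sum>c\<in>?F. add_char p (f * m) (c * x)) = (if trace_rel q m x = 0 then of_nat q else 0)"
  proof (cases "trace_rel q m x = 0")
    case True
    have "add_char p (f * m) (c * x) = 1" if "c \<in> ?F" for c
      using True that p_gt_2
      by (simp only: add_char_eq_1_iff trace_tower mem trace_rel_scale) (simp add: power_0_left)
    then have "(\<Sum>c\<in>?F. add_char p (f * m) (c * x)) = of_nat (card ?F)" by simp
    then show ?thesis using True by (simp only: card_subfield simp_thms if_True)
  next
    case False
    define t where "t = trace_rel q m x"
    have t: "t \<noteq> 0" "t ^ q = t" using False trace_rel_in_subfield by (auto simp: t_def)
    have "card {c :: 'a. (\<Sum>i<f. c ^ p ^ i) = 0} \<le> p ^ (f - 1)"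
      using card_additive_poly_zeros fm_pos p_gt_2 by simp
    also have "\<dots> < q" unfolding q_def using fm_pos p_gt_2 by (intro power_strict_increasing) auto
    finally have "card {c :: 'a. (\<Sum>i<f. c ^ p ^ i) = 0} < card ?F" using card_subfield by simp
    then have "\<not> ?F \<subseteq> {c :: 'a. (\<Sum>i<f. c ^ p ^ i) = 0}" by (meson card_mono finite leD)
    then obtain c :: 'a where c: "c ^ q = c" "(\<Sum>i<f. c ^ p ^ i) \<noteq> 0" using mem by blast
    \<comment> \<open>The multiple of \<open>x\<close> by \<open>c / t\<close> has relative trace
      \<open>c\<close>, and \<open>c\<close> was chosen so that the tower formula then gives a
      nonzero absolute trace.\<close>
    have ct: "(c / t) ^ q = c / t" by (simp only: power_divide c t)
    have "trace_rel q m (c / t * x) = c"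
      unfolding trace_rel_scale[OF ct] t_def[symmetric] using t(1) by simp
    then have "trace_abs p (f * m) (c / t * x) \<noteq> 0"
      using c(2) by (simp only: trace_tower not_False_eq_True)
    then have "add_char p (f * m) (c / t * x) \<noteq> 1" by (simp add: add_char_eq_1_iff)
    then have "(\<Sum>y\<in>(\<lambda>c. c * x) ` ?F. add_char p (f * m) y) = 0"
    proof (rule sum_char_zero[rotated 3])
      show "c / t * x \<in> (\<lambda>c. c * x) ` ?F" using ct mem by blast
      show "y + z \<in> (\<lambda>c. c * x) ` ?F" if yz: "y \<in> (\<lambda>c. c * x) ` ?F" "z \<in> (\<lambda>c. c * x) ` ?F" for y z
      proof -
        obtain a b where "y = a * x" "z = b * x" "a ^ q = a" "b ^ q = b"
          using yz mem by blast
        then have "y + z = (a + b) * x" "(a + b) ^ q = a + b"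
          by (simp_all add: power_q_add ring_distribs)
        then show ?thesis using mem by blast
      qed
      show "- y \<in> (\<lambda>c. c * x) ` ?F" if y: "y \<in> (\<lambda>c. c * x) ` ?F" for y
      proof -
        obtain a where a: "y = a * x" "a ^ q = a" using y mem by blast
        have "odd q" using odd_p by (simp add: q_def)
        then have "- y = (- a) * x" "(- a) ^ q = - a" using a by simp_all
        then show ?thesis using mem by blast
      qed
    qed
    moreover have "inj_on (\<lambda>c. c * x) ?F" using x by (auto simp: inj_on_def)
    ultimately show ?thesis using False by (simp add: sum.reindex)
  qed
  then show ?thesis by (simp add: algebra_simps)
qed

text \<open>Multiplicative orbits of the subfield have length \<open>q - 1\<close>, so the division in
  \<^const>\<open>sub_n\<close> is exact.\<close>

lemma card_U_invariant:
  assumes "0 \<notin> T" and inv: "\<And>c x. c \<in> U \<Longrightarrow> x \<in> T \<Longrightarrow> c * x \<in> T"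
  shows "(q - 1) dvd card T"
proof -
  \<comment> \<open>\<open>T\<close> is a union of cosets of \<open>U\<close>, each with
    \<open>q - 1\<close> elements; \<open>R\<close> holds one exponent for each coset.\<close>
  define R where "R = {i \<in> {0..<int M}. w powi i \<in> T}"
  have "cyc_class w M i \<subseteq> T" if "i \<in> R" for i
  proof
    fix x assume "x \<in> cyc_class w M i"
    then obtain j where j: "x = w powi (i + int M * j)" by (auto simp: cyc_class_def)
    have "w powi (int M * j) \<in> U" by (auto simp: U_def cyc_class_def)
    then have "w powi (int M * j) * w powi i \<in> T" using that inv by (simp add: R_def)
    then show "x \<in> T" by (simp add: j power_int_add mult.commute)
  qed
  moreover have "T \<subseteq> (\<Union>i\<in>R. cyc_class w M i)"
  proof
    fix x assume x: "x \<in> T"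
    then have "x \<in> (\<Union>i\<in>{0..<int M}. cyc_class w M i)" using assms(1) cyc_classes_cover[OF M_dvd] by auto
    then obtain i where i: "i \<in> {0..<int M}" "x \<in> cyc_class w M i" by auto
    then obtain j where j: "x = w powi (i + int M * j)" by (auto simp: cyc_class_def)
    have "w powi (int M * (- j)) \<in> U" unfolding U_def cyc_class_def
      by (intro CollectI exI[of _ "- j"]) simp
    then have "w powi (int M * (- j)) * x \<in> T" using x inv by blast
    also have "w powi (int M * (- j)) * x = w powi i"
      unfolding j by (subst power_int_add[symmetric]) auto
    finally show "x \<in> (\<Union>i\<in>R. cyc_class w M i)" using i by (auto simp: R_def)
  qed
  ultimately have "T = (\<Union>i\<in>R. cyc_class w M i)" by auto
  moreover have "card (\<Union>i\<in>R. cyc_class w M i) = (\<Sum>i\<in>R. card (cyc_class w M i))"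
  proof (rule card_UN_disjoint)
    show "finite R" by (rule finite_subset[of _ "{0..<int M}"]) (auto simp: R_def)
  qed (use cyc_classes_disjoint[OF M_dvd] in \<open>auto simp: R_def\<close>)
  moreover have "card (cyc_class w M i) = q - 1" for i
  proof -
    have "M * card (cyc_class w M i) = M * (q - 1)" using card_cyc_class[OF M_dvd, of i] M_mult by simp
    moreover have "M > 0" using M_mult Q_pos by (cases M) auto
    ultimately show ?thesis by simp
  qed
  ultimately show ?thesis by simp
qed

text \<open>Since \<open>N dvd M\<close>, multiplication by an element of \<open>U\<close> preserves
  each class. Averaging over \<open>U\<close> and evaluating the sums over lines leaves only the
  count of elements of relative trace 0. The periods are thus integers, with \<open>k\<close> the
  class size divided by \<open>q - 1\<close>.\<close>

lemma period_eq_sub_n: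
  assumes N: "N dvd M"
  obtains k :: int where "\<And>i. period N i = of_int (int q * sub_n w q m N i - k)"
proof -
  have NQ: "N dvd Q" using N M_dvd by (rule dvd_trans)
  have inv: "c * x \<in> cyc_class w N i \<longleftrightarrow> x \<in> cyc_class w N i" if "c \<in> U" for c x i
  proof -
    obtain j where j: "c = w powi (int M * j)" using \<open>c \<in> U\<close> by (auto simp: U_def cyc_class_def)
    have "cyc_class w N (i - int M * j) = cyc_class w N i"
      using N by (intro cyc_class_cong) auto
    then show ?thesis by (simp add: j cyc_class_mult_iff[OF NQ])
  qed
  define K where "K = Q div N div (q - 1)"
  have N0: "N > 0" using NQ Q_pos by (cases N) auto
  have card: "card (cyc_class w N i) = (q - 1) * K" for i
  proof -
    have c: "card (cyc_class w N i) = Q div N"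
      using card_cyc_class[OF NQ, of i] N0 by (metis nonzero_mult_div_cancel_left not_gr0)
    have "(q - 1) dvd card (cyc_class w N i)" by (rule card_U_invariant) (use inv in auto)
    then show ?thesis by (simp add: c K_def)
  qed
  have "period N i = of_int (int q * sub_n w q m N i - int K)" for i
  proof -
    let ?Z = "{x \<in> cyc_class w N i. trace_rel q m x = 0}"
    have "(q - 1) dvd card ?Z"
      by (rule card_U_invariant) (use inv U_iff trace_rel_scale in auto)
    then obtain z where z: "card ?Z = (q - 1) * z" by auto
    have sub: "sub_n w q m N i = int z"
      using q_gt_2 by (simp add: sub_n_def z del: of_nat_diff)
    have orbit: "(\<Sum>x\<in>cyc_class w N i. add_char p (f * m) (c * x)) = period N i" if "c \<in> U" for c
      unfolding period_def
      by (rule sum.reindex_bij_witness[of _ "\<lambda>x. x / c" "\<lambda>x. c * x"])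
         (use that inv[OF that] in \<open>auto simp: inv[OF that, of "_ / c", symmetric]\<close>)
    have "of_nat (q - 1) * period N i = (\<Sum>c\<in>U. \<Sum>x\<in>cyc_class w N i. add_char p (f * m) (c * x))"
      by (simp add: orbit card_U)
    also have "\<dots> = (\<Sum>x\<in>cyc_class w N i. \<Sum>c\<in>U. add_char p (f * m) (c * x))"
      by (rule sum.swap)
    also have "\<dots> = (\<Sum>x\<in>cyc_class w N i. (if trace_rel q m x = 0 then of_nat q else 0) - 1)"
      by (intro sum.cong refl sum_add_char_line) auto
    also have "\<dots> = of_nat q * of_nat (card ?Z) - of_nat (card (cyc_class w N i))"
      by (simp add: sum_subtractf sum.If_cases Int_def mult.commute)
    also have "\<dots> = of_nat (q - 1) * (of_nat q * of_nat z - of_nat K)"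
      unfolding z card of_nat_mult by (simp only: algebra_simps)
    finally have "period N i = of_nat q * of_nat z - of_nat K"
      using q_gt_2 by (subst (asm) mult_left_cancel) auto
    then show ?thesis by (simp add: sub)
  qed
  then show thesis by (rule that)
qed


text \<open>The element 2 lies in the prime field, hence in \<open>U\<close>, which is contained in
  the class of 0 of order \<open>N\<close>.\<close>

lemma two_in_cyc_class:
  assumes "N dvd M"
  shows "2 \<in> cyc_class w N 0"
proof -
  have "(1 + 1 :: 'a) ^ q = 1 + 1" by (simp only: power_q_add power_one)
  then have "2 \<in> U" using two_nonzero U_iff by simp
  then have "int M dvd dlog 2" using in_cyc_class_iff[OF M_dvd] by (simp add: U_def)
  then have "int N dvd dlog 2" using assms by (meson dvd_trans int_dvd_int_iff)
  then show ?thesis using in_cyc_class_iff[OF dvd_trans[OF assms M_dvd]] two_nonzero by simp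
qed

section \<open>Two-valued periods and the subdifference set\<close>

lemma period_two_values:
  assumes N: "N dvd M" "N \<ge> 2"
    and srg: "strongly_regular (UNIV :: 'a set) (cayley_adj (cyc_class w N 0))"
  shows "\<exists>b. b \<noteq> period N 0 \<and> (\<forall>i. period N i \<in> {period N 0, b}) \<and> (\<exists>i\<in>{0..<int N}. period N i = b)"
proof -
  have NQ: "N dvd Q" using N(1) M_dvd by (rule dvd_trans)
  obtain k where k: "\<And>i. period N i = of_int (int q * sub_n w q m N i - k)"
    using period_eq_sub_n[OF N(1)] by blast
  obtain A B where AB: "\<And>i. period N i * period N i = A + B * period N i"
    using srg_period_quadratic[OF NQ srg] by blast
  have "\<exists>i\<in>{0..<int N}. period N i \<noteq> period N 0"
  proof (rule ccontr)
    assume "\<not> ?thesis"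
    then have "(\<Sum>i\<in>{0..<int N}. period N i) = (\<Sum>i\<in>{0..<int N}. period N 0)"
      by (intro sum.cong[OF refl]) blast
    then have "of_nat N * period N 0 = - 1" using sum_period[OF NQ] by simp
    \<comment> \<open>If all periods were equal, \<open>N\<close> times an integer would be
      -1.\<close>
    then have "of_int (int N * (int q * sub_n w q m N 0 - k)) = (of_int (- 1) :: complex)"
      unfolding k by simp
    then have "int N * (int q * sub_n w q m N 0 - k) = - 1" by (simp only: of_int_eq_iff)
    then have "int N dvd - 1" by (metis dvd_triv_left)
    then show False using N(2) by simp
  qed
  then obtain i where i: "i \<in> {0..<int N}" "period N i \<noteq> period N 0" by blast
  \<comment> \<open>Two distinct periods are the two roots of one quadratic, and these add up to
    \<open>B\<close>.\<close>
  have other: "period N j = B - period N 0" if "period N j \<noteq> period N 0" for j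
  proof -
    have "(period N j - period N 0) * (period N j + period N 0 - B) = 0"
      using AB[of j] AB[of 0] by (simp add: algebra_simps)
    then have "period N j + period N 0 - B = 0" using that by simp
    then show ?thesis by (simp add: algebra_simps)
  qed
  then have "period N j = period N 0 \<or> period N j = period N i" for j using i(2) by metis
  then show ?thesis using i by blast
qed

text \<open>Each period is an affine function of \<open>sub_n\<close> with slope \<open>q\<close>,
  so \<open>sub_n\<close> is two-valued as well and the description in \<open>sub_delta\<close>
  singles out one number. Membership becomes a condition on periods, which are defined at every
  integer index.\<close>

lemma subdiff_set_iff:
  assumes N: "N dvd M" "N \<ge> 2"
    and srg: "strongly_regular (UNIV :: 'a set) (cayley_adj (cyc_class w N 0))"
  shows "a mod int N \<in> subdiff_set w q m N \<longleftrightarrow> period N a \<noteq> period N 0"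
proof -
  obtain k where k: "\<And>i. period N i = of_int (int q * sub_n w q m N i - k)"
    using period_eq_sub_n[OF N(1)] by blast
  have same: "sub_n w q m N i = sub_n w q m N j \<longleftrightarrow> period N i = period N j" for i j
    using q_gt_2 unfolding k by (simp only: of_int_eq_iff) auto
  obtain b where b: "b \<noteq> period N 0" "\<And>i. period N i = period N 0 \<or> period N i = b"
      "\<exists>i\<in>{0..<int N}. period N i = b"
    using period_two_values[OF assms] by auto
  obtain r where r: "r \<in> {0..<int N}" "period N r = b" using b(3) by blast
  let ?d = "sub_n w q m N r - sub_n w q m N 0"
  have diff: "sub_n w q m N i - sub_n w q m N 0 = ?d \<longleftrightarrow> period N i \<noteq> period N 0" for i
    using same[of i r] b(1) b(2)[of i] r(2) by auto
  have zero: "sub_n w q m N i - sub_n w q m N 0 = 0 \<longleftrightarrow> period N i = period N 0" for i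
    using same[of i 0] by auto
  have "sub_delta w q m N = ?d"
    unfolding sub_delta_def
  proof (rule the_equality)
    show "?d \<noteq> 0 \<and> (\<forall>i\<in>{0..<int N}. sub_n w q m N i - sub_n w q m N 0 \<in> {0, ?d}) \<and>
      (\<exists>i\<in>{0..<int N}. sub_n w q m N i - sub_n w q m N 0 = ?d)"
      using r b(1) zero diff by blast
  next
    fix d assume d: "d \<noteq> 0 \<and> (\<forall>i\<in>{0..<int N}. sub_n w q m N i - sub_n w q m N 0 \<in> {0, d}) \<and>
      (\<exists>i\<in>{0..<int N}. sub_n w q m N i - sub_n w q m N 0 = d)"
    then have "?d \<in> {0, d}" using r(1) by blast
    moreover have "?d \<noteq> 0" using zero[of r] r(2) b(1) by simp
    ultimately show "d = ?d" by simp
  qed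
  moreover have "a mod int N \<in> {0..<int N}" using N(2) by simp
  moreover have "period N (a mod int N) = period N a"
    by (rule period_cong) (simp add: mod_eq_dvd_iff[symmetric])
  ultimately show ?thesis using diff[of "a mod int N"] by (simp add: subdiff_set_def)
qed

text \<open>Writing the periods as \<open>P = P(0) + d 1\<^bsub>I\<^esub>\<close> turns the convolution identity for the periods into
  one for the indicator function of \<open>I\<close>; the constant parts cancel.\<close>

lemma indicator_convolution:
  assumes N: "N dvd M" "N \<ge> 2" "odd N"
    and srg: "strongly_regular (UNIV :: 'a set) (cayley_adj (cyc_class w N 0))"
    and semi: "\<And>a. period N (- 2 * a) = period N a"
  shows "(\<Sum>y | y \<noteq> 0 \<and> period N (c - dlog y) \<noteq> period N 0. quad_char y * add_char p (f * m) y) =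
    (if period N (- c) \<noteq> period N 0 then gauss_quad p (f * m) TYPE('a) else 0)"
    (is "?T = ?R")
proof -
  let ?g = "\<lambda>y :: 'a. quad_char y * add_char p (f * m) y"
  have NQ: "N dvd Q" using N(1) M_dvd by (rule dvd_trans)
  obtain b where b: "b \<noteq> period N 0" "\<And>i. period N i = period N 0 \<or> period N i = b"
    using period_two_values[OF N(1,2) srg] by auto
  let ?d = "b - period N 0" and ?G = "gauss_quad p (f * m) TYPE('a)"
  have ind: "period N i = period N 0 + (if period N i \<noteq> period N 0 then ?d else 0)" for i
    using b(2)[of i] by auto
  \<comment> \<open>\<open>s\<close> is half of \<open>c\<close> modulo the odd number
    \<open>N\<close>.\<close>
  obtain s where s: "int N dvd 2 * s - c"
  proof -
    have "coprime 2 (int N)" using N(3) by simp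
    then obtain t where "[2 * t = 1] (mod int N)" by (metis cong_solve_coprime_int)
    then have "[2 * t * c = 1 * c] (mod int N)" by (rule cong_scalar_right)
    then have "int N dvd 2 * (t * c) - c" by (simp add: cong_iff_dvd_diff mult.assoc)
    then show thesis by (rule that)
  qed
  \<comment> \<open>The convolution produces the index \<open>s\<close>; \<open>semi\<close>
    replaces it by \<open>- 2 * s\<close>, that is by \<open>- c\<close>.\<close>
  have "period N (- c) = period N (- 2 * s)" using s by (intro period_cong) simp
  then have ps: "period N s = period N (- c)" using semi[of s] by simp
  have "?G * period N (- c) = (\<Sum>y\<in>-{0}. period N (c - dlog y) * ?g y)"
    using period_convolution[OF NQ N(3) two_in_cyc_class[OF N(1)] s] ps by simp
  also have "\<dots> = (\<Sum>y\<in>-{0}. period N 0 * ?g y + ?d * (if period N (c - dlog y) \<noteq> period N 0 then ?g y else 0))"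
    by (intro sum.cong refl, subst ind) (simp add: algebra_simps)
  also have "\<dots> = period N 0 * (\<Sum>y\<in>-{0}. ?g y)
      + ?d * (\<Sum>y\<in>-{0}. if period N (c - dlog y) \<noteq> period N 0 then ?g y else 0)"
    by (simp only: sum.distrib sum_distrib_left)
  also have "(\<Sum>y\<in>-{0}. ?g y) = ?G" by (simp add: gauss_quad_def Compl_eq_Diff_UNIV)
  also have "(\<Sum>y\<in>-{0}. if period N (c - dlog y) \<noteq> period N 0 then ?g y else 0) = ?T"
    by (subst sum.inter_filter[symmetric]) auto
  finally have "?d * ?T = ?G * (period N (- c) - period N 0)" by (simp add: algebra_simps)
  also have "\<dots> = ?d * ?R" by (subst ind) simp
  finally show ?thesis using b(1) by simp
qed

text \<open>In terms of \<open>dlog y - c\<close>, the union over \<open>X\<close> is the even part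
  of the union over \<open>H\<close>. Twice the even part minus the whole weights \<open>y\<close>
  by the parity sign of \<open>dlog y - c\<close>, which is \<open>quad_char y\<close> up to the
  parity sign of \<open>c\<close>.\<close>

lemma sum_doubled_classes:
  assumes N: "N dvd M" "N \<ge> 2" "odd N"
    and srg: "strongly_regular (UNIV :: 'a set) (cayley_adj (cyc_class w N 0))"
    and semi: "\<And>a. period N (- 2 * a) = period N a"
  defines "H \<equiv> {u \<in> {0..<int N}. (2 * u) mod int N \<in> subdiff_set w q m N}"
    and "X \<equiv> {(2 * t) mod (2 * int N) | t. t \<in> {0..<int N} \<and> (4 * t) mod int N \<in> subdiff_set w q m N}"
  shows "2 * add_char_set p (f * m) ((\<lambda>x. w powi c * x) ` (\<Union>t\<in>X. cyc_class w (2 * N) t))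
       - add_char_set p (f * m) ((\<lambda>x. w powi c * x) ` (\<Union>t\<in>H. cyc_class w N t))
       = (if even c then 1 else - 1) * (if c mod int N \<in> H then gauss_quad p (f * m) TYPE('a) else 0)"
proof -
  let ?\<psi> = "add_char p (f * m) :: 'a \<Rightarrow> complex"
  have NQ: "N dvd Q" using N(1) M_dvd by (rule dvd_trans)
  have N2Q: "2 * N dvd Q" using NQ even_Q N(3) by (intro divides_mult) auto
  define J where "J = (\<lambda>a. (2 * a) mod int N \<in> subdiff_set w q m N)"
  \<comment> \<open>\<open>semi\<close> at \<open>- a\<close> trades the doubled index for a negated
    one, the form that occurs in \<open>indicator_convolution\<close>.\<close>
  have J: "J a \<longleftrightarrow> period N (- a) \<noteq> period N 0" for a
    unfolding J_def subdiff_set_iff[OF N(1,2) srg] using semi[of "- a"] by simp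
  have J_mod: "J (a mod int N) \<longleftrightarrow> J a" for a by (simp add: J_def mod_mult_right_eq)
  have image: "(\<lambda>x. w powi c * x) ` (\<Union>t\<in>S. cyc_class w K t) =
      {y. y \<noteq> 0 \<and> (\<exists>t\<in>S. int K dvd dlog y - (c + t))}" if "K dvd Q" for K S
  proof -
    have "(\<lambda>x. w powi c * x) ` cyc_class w K t = cyc_class w K (t + c)" for t
      using bij_mult_cyc_class[OF that] by (rule bij_betw_imp_surj_on)
    then have "(\<lambda>x. w powi c * x) ` (\<Union>t\<in>S. cyc_class w K t) = (\<Union>t\<in>S. cyc_class w K (t + c))"
      by (simp add: image_UN)
    then show ?thesis by (auto simp: in_cyc_class_iff[OF that] add.commute)
  qed
  have H_iff: "(\<exists>t\<in>H. int N dvd i - (c + t)) \<longleftrightarrow> J (i - c)" for i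
  proof
    assume "\<exists>t\<in>H. int N dvd i - (c + t)"
    then obtain t where t: "t \<in> H" "int N dvd (i - c) - t" by (auto simp: algebra_simps)
    then have "(i - c) mod int N = t mod int N" by (simp add: mod_eq_dvd_iff)
    moreover have "J t" using t by (simp add: H_def J_def)
    ultimately show "J (i - c)" by (metis J_mod)
  next
    assume "J (i - c)"
    then have "(i - c) mod int N \<in> H" using N(2) J_mod[of "i - c"] by (simp add: H_def J_def)
    moreover have "int N dvd i - (c + (i - c) mod int N)"
      by (simp add: diff_diff_eq[symmetric] mod_eq_dvd_iff[symmetric])
    ultimately show "\<exists>t\<in>H. int N dvd i - (c + t)" by blast
  qed
  have X_iff: "(\<exists>t\<in>X. int (2 * N) dvd i - (c + t)) \<longleftrightarrow> even (i - c) \<and> J (i - c)" for i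
  proof
    assume "\<exists>t\<in>X. int (2 * N) dvd i - (c + t)"
    then obtain t where t: "J (2 * t)" "2 * int N dvd (i - c) - (2 * t) mod (2 * int N)"
      by (auto simp: X_def J_def algebra_simps)
    then have *: "2 * int N dvd (i - c) - 2 * t" by (metis mod_eq_dvd_iff mod_mod_trivial)
    have "int N dvd (i - c) - 2 * t" using * by (metis dvd_mult_right)
    then have "J (i - c)" using t(1) by (metis J_mod mod_eq_dvd_iff)
    moreover have "2 dvd (i - c) - 2 * t" using * by (metis dvd_mult_left)
    then have "even (i - c)" by presburger
    ultimately show "even (i - c) \<and> J (i - c)" by blast
  next
    assume *: "even (i - c) \<and> J (i - c)"
    then obtain s where s: "i - c = 2 * s" by blast
    \<comment> \<open>Reducing \<open>s\<close> modulo \<open>N\<close> changes \<open>2 * s\<close>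
      only by a multiple of \<open>2 * N\<close>.\<close>
    define t where "t = s mod int N"
    have "t \<in> {0..<int N}" using N(2) by (simp add: t_def)
    moreover have "J (2 * t)"
    proof -
      have "(2 * t) mod int N = (2 * s) mod int N" by (simp add: t_def mod_mult_right_eq)
      then show ?thesis using * s by (metis J_mod)
    qed
    ultimately have "(2 * t) mod (2 * int N) \<in> X"
      unfolding X_def J_def by (intro CollectI exI[of _ t]) simp
    moreover have "(2 * t) mod (2 * int N) = (2 * s) mod (2 * int N)"
      by (simp add: t_def)
    moreover have "int (2 * N) dvd (i - c) - (2 * s) mod (2 * int N)"
      unfolding s by (simp add: mod_eq_dvd_iff[symmetric])
    ultimately show "\<exists>t\<in>X. int (2 * N) dvd i - (c + t)" by (metis diff_diff_eq)
  qed
  let ?A = "{y :: 'a. y \<noteq> 0 \<and> J (dlog y - c)}"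
  let ?B = "{y \<in> ?A. even (dlog y - c)}"
  have sign: "2 * (if even (dlog y - c) then ?\<psi> y else 0) - ?\<psi> y =
      (if even c then 1 else - 1) * (quad_char y * ?\<psi> y)" if "y \<noteq> 0" for y
    using quad_char_w[of "dlog y"] powi_dlog[OF that] by auto
  have "2 * add_char_set p (f * m) ((\<lambda>x. w powi c * x) ` (\<Union>t\<in>X. cyc_class w (2 * N) t))
       - add_char_set p (f * m) ((\<lambda>x. w powi c * x) ` (\<Union>t\<in>H. cyc_class w N t))
      = 2 * (\<Sum>y\<in>?B. ?\<psi> y) - (\<Sum>y\<in>?A. ?\<psi> y)"
    unfolding add_char_set_def image[OF NQ] image[OF N2Q] H_iff X_iff
    by (simp add: conj_ac)
  also have "\<dots> = (\<Sum>y\<in>?A. 2 * (if even (dlog y - c) then ?\<psi> y else 0) - ?\<psi> y)"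
    unfolding sum_subtractf sum_distrib_left[symmetric] by (subst sum.inter_filter) simp_all
  also have "\<dots> = (\<Sum>y\<in>?A. (if even c then 1 else - 1) * (quad_char y * ?\<psi> y))"
    by (rule sum.cong[OF refl], rule sign) simp
  also have "\<dots> = (if even c then 1 else - 1) * (\<Sum>y\<in>?A. quad_char y * ?\<psi> y)"
    by (rule sum_distrib_left[symmetric])
  also have "(\<Sum>y\<in>?A. quad_char y * ?\<psi> y) = (if J c then gauss_quad p (f * m) TYPE('a) else 0)"
    using indicator_convolution[OF N srg semi, of c] by (simp add: J)
  also have "J c \<longleftrightarrow> c mod int N \<in> H"
    using J_mod[of c] N(2) by (simp add: H_def J_def)
  finally show ?thesis .
qed

end

theorem theorem6p1:
  fixes p f m N :: nat and w :: "'a::{finite,field}" and c :: int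
  assumes "prime p" and "odd p" and "f \<ge> 1" and "m \<ge> 2"
    and "CARD('a) = (p ^ f) ^ m"
    and "primitive_element w"
    and "odd N" and "N \<ge> 2" and "N dvd ((p ^ f) ^ m - 1) div (p ^ f - 1)"
    and "strongly_regular (UNIV::'a set) (cayley_adj (cyc_class w N 0))"
    and "\<exists>k::nat. int p ^ k mod int N = (- 2) mod int N"
  shows
    "let q = p ^ f; I = subdiff_set w q m N;
         H = {u \<in> {0..<int N}. (2 * u) mod int N \<in> I};
         X = {(2 * t) mod (2 * int N) | t. t \<in> {0..<int N} \<and> (4 * t) mod int N \<in> I};
         L = 2 * add_char_set p (f * m) ((\<lambda>x. w powi c * x) ` (\<Union>t\<in>X. cyc_class w (2 * N) t))
             - add_char_set p (f * m) ((\<lambda>x. w powi c * x) ` (\<Union>t\<in>H. cyc_class w N t));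
         G = gauss_quad p (f * m) TYPE('a)
     in (c mod int N \<in> H \<longrightarrow> (L = G \<or> L = - G)) \<and> (c mod int N \<notin> H \<longrightarrow> L = 0)"
proof -
  interpret finite_field_tower p f m w
    using assms by unfold_locales (simp_all add: power_mult Suc_leI)
  have N: "N dvd M" using assms by (simp add: M_def q_def)
  obtain k :: nat where k: "int p ^ k mod int N = (- 2) mod int N" using assms by blast
  \<comment> \<open>Multiplying an index by \<open>p\<close> does not change the period, and
    \<open>p ^ k\<close> is -2 modulo \<open>N\<close>.\<close>
  have semi: "period N (- 2 * a) = period N a" for a
  proof -
    have "(- 2 * a) mod int N = (int p ^ k * a) mod int N" using k by (metis mod_mult_left_eq)
    then have "period N (- 2 * a) = period N (int p ^ k * a)"
      by (intro period_cong) (simp only: mod_eq_dvd_iff)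
    then show ?thesis using period_mult_char_power[OF dvd_trans[OF N M_dvd]] by simp
  qed
  \<comment> \<open>The sign of the Gauss sum is plus for even \<open>c\<close> and minus for odd
    \<open>c\<close>.\<close>
  show ?thesis
    unfolding Let_def q_def[symmetric] sum_doubled_classes[OF N assms(8,7,10) semi, of c]
    by simp
qed

end
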